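(* Let $K$ be a field of characteristic zero, let $\mathfrak{g}=(V,[\,,])$ be a Lie algebra over $K$, and let $(V,\cdot)$ be a CPA-structure on $\mathfrak{g}$. Then the following properties are equivalent: (1) $\mathfrak{g}\cdot[\mathfrak{g},\mathfrak{g}]=0$, i.e. $x\cdot[y,z]=0$ for all $x,y,z\in V$; (2) $(V,\cdot)$ is an associative algebra; (3) $(V,\cdot)$ is a Poisson-admissible algebra.
   Context: A commutative post-Lie algebra structure (CPA-structure) on a Lie algebra $\mathfrak{g}=(V,[\,,])$ over $K$ is a $K$-bilinear product $x\cdot y$ on $V$ such that for all $x,y,z\in V$: $x\cdot y=y\cdot x$; $[x,y]\cdot z=x\cdot(y\cdot z)-y\cdot(x\cdot z)$; $x\cdot[y,z]=[x\cdot y,z]+[y,x\cdot z]$. A Poisson algebra is a triple $(V,\circ,[\,,]_P)$ where $(V,\circ)$ is a commutative associative algebra, $(V,[\,,]_P)$ is a Lie algebra, and $[x,y\circ z]_P=[x,y]_P\circ z+y\circ[x,z]_P$ for all $x,y,z\in V$. An algebra $(V,\cdot)$ (vector space with a bilinear product, not assumed associative) is Poisson-admissible if $(V,\circ,[\,,]_P)$ with $[x,y]_P=x\cdot y-y\cdot x$ and $x\circ y=\frac12(x\cdot y+y\cdot x)$ is a Poisson algebra. (The bracket $[\,,]_P$ here is the one built from the product $\cdot$, not the given Lie bracket of $\mathfrak{g}$.) *)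

theory Defs
  imports Complex_Main
begin

text \<open>
  The underlying vector space \<open>V\<close> is a type with scalar multiplication \<open>scale\<close>. Algebras are not
  assumed to be unital, and associativity is never part of the bare notion of algebra.
\<close>

locale bilinear_algebra = vector_space scale
  for scale :: "'k::field \<Rightarrow> 'v::ab_group_add \<Rightarrow> 'v" +
  fixes mult :: "'v \<Rightarrow> 'v \<Rightarrow> 'v"  (infixl "\<cdot>" 70)
  assumes linear_left: "Vector_Spaces.linear scale scale (\<lambda>x. x \<cdot> y)"
    and linear_right: "Vector_Spaces.linear scale scale (\<lambda>y. x \<cdot> y)"

locale associative_algebra = bilinear_algebra scale mult
  for scale :: "'k::field \<Rightarrow> 'v::ab_group_add \<Rightarrow> 'v"
    and mult :: "'v \<Rightarrow> 'v \<Rightarrow> 'v"  (infixl "\<cdot>" 70) +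
  assumes assoc: "(x \<cdot> y) \<cdot> z = x \<cdot> (y \<cdot> z)"

locale commutative_associative_algebra = associative_algebra scale mult
  for scale :: "'k::field \<Rightarrow> 'v::ab_group_add \<Rightarrow> 'v"
    and mult :: "'v \<Rightarrow> 'v \<Rightarrow> 'v"  (infixl "\<cdot>" 70) +
  assumes comm: "x \<cdot> y = y \<cdot> x"

locale lie_algebra = bilinear_algebra scale bracket
  for scale :: "'k::field \<Rightarrow> 'v::ab_group_add \<Rightarrow> 'v"
    and bracket :: "'v \<Rightarrow> 'v \<Rightarrow> 'v" +
  assumes alternating: "bracket x x = 0"
    and jacobi: "bracket x (bracket y z) + bracket y (bracket z x) + bracket z (bracket x y) = 0"

locale cpa_structure =
  lie_algebra scale bracket + product: bilinear_algebra scale mult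
  for scale :: "'k::field \<Rightarrow> 'v::ab_group_add \<Rightarrow> 'v"
    and bracket :: "'v \<Rightarrow> 'v \<Rightarrow> 'v"
    and mult :: "'v \<Rightarrow> 'v \<Rightarrow> 'v"  (infixl "\<cdot>" 70) +
  assumes product_comm: "x \<cdot> y = y \<cdot> x"
    and bracket_product: "bracket x y \<cdot> z = x \<cdot> (y \<cdot> z) - y \<cdot> (x \<cdot> z)"
    and product_bracket: "x \<cdot> bracket y z = bracket (x \<cdot> y) z + bracket y (x \<cdot> z)"

locale poisson_algebra =
  commutative_associative_algebra scale circ + lie: lie_algebra scale bracket
  for scale :: "'k::field \<Rightarrow> 'v::ab_group_add \<Rightarrow> 'v"
    and circ :: "'v \<Rightarrow> 'v \<Rightarrow> 'v"
    and bracket :: "'v \<Rightarrow> 'v \<Rightarrow> 'v" +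
  assumes leibniz: "bracket x (circ y z) = circ (bracket x y) z + circ y (bracket x z)"

locale poisson_admissible_algebra =
  bilinear_algebra scale mult +
  poisson: poisson_algebra scale
    "\<lambda>x y. scale (1 / 2) (mult x y + mult y x)"
    "\<lambda>x y. mult x y - mult y x"
  for scale :: "'k::field_char_0 \<Rightarrow> 'v::ab_group_add \<Rightarrow> 'v"
    and mult :: "'v \<Rightarrow> 'v \<Rightarrow> 'v"

end

theory Submission
  imports Defs
begin

text \<open>
  For a commutative product, associativity says exactly that left multiplications commute, and the
  second CPA-axiom identifies their commutators with the left multiplications by Lie brackets.
  Commutativity also makes the Poisson bracket vanish and the symmetrized product equal to the
  given one, so that Poisson-admissibility is just associativity.
\<close>

context cpa_structure
begin

lemma bracket_annihilates_iff_associative: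
  "(\<forall>x y z. x \<cdot> bracket y z = 0) \<longleftrightarrow> associative_algebra scale mult"
proof
  assume ann: "\<forall>x y z. x \<cdot> bracket y z = 0"
  show "associative_algebra scale mult"
  proof
    fix x y z
    \<comment> \<open>The left side is \<open>bracket x z \<cdot> y\<close>, hence
      \<open>y \<cdot> bracket x z\<close> by commutativity. With \<open>y\<close> innermost,
      commutativity alone turns the resulting equality into associativity.\<close>
    have "x \<cdot> (z \<cdot> y) - z \<cdot> (x \<cdot> y) = 0"
      using ann by (metis bracket_product product_comm)
    then show "(x \<cdot> y) \<cdot> z = x \<cdot> (y \<cdot> z)"
      by (simp add: product_comm)
  qed
next
  assume "associative_algebra scale mult"
  then interpret associative_algebra scale mult .
  show "\<forall>x y z. x \<cdot> bracket y z = 0"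
  proof (intro allI)
    fix x y z
    have "x \<cdot> bracket y z = y \<cdot> (z \<cdot> x) - z \<cdot> (y \<cdot> x)"
      by (simp only: product_comm[of x] bracket_product)
    also have "\<dots> = (y \<cdot> z) \<cdot> x - (z \<cdot> y) \<cdot> x"
      by (simp only: assoc)
    also have "\<dots> = 0"
      by (simp only: product_comm[of z y] diff_self)
    finally show "x \<cdot> bracket y z = 0" .
  qed
qed

end

lemma (in vector_space) lie_algebra_zero: "lie_algebra scale (\<lambda>x y. 0)"
  by unfold_locales simp_all

text \<open>Over the zero bracket the Leibniz rule is trivial. This is the case that a commutative
  product produces.\<close>

lemma poisson_algebra_zero_bracket_iff:
  "poisson_algebra scale mult (\<lambda>x y. 0) \<longleftrightarrow> commutative_associative_algebra scale mult"
proof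
  assume "commutative_associative_algebra scale mult"
  then interpret commutative_associative_algebra scale mult .
  interpret lie: lie_algebra scale "\<lambda>x y. 0"
    by (rule lie_algebra_zero)
  \<comment> \<open>The right side of the Leibniz rule becomes \<open>mult 0 z + mult y 0\<close>,
    which vanishes by linearity in each argument.\<close>
  have "mult 0 x = 0" "mult x 0 = 0" for x
    using module_hom.zero[OF Vector_Spaces.linear.axioms(3)[OF linear_left[of x]]]
      module_hom.zero[OF Vector_Spaces.linear.axioms(3)[OF linear_right[of x]]] by simp_all
  then show "poisson_algebra scale mult (\<lambda>x y. 0)"
    by unfold_locales simp_all
qed (rule poisson_algebra.axioms(1))

lemma associative_iff_poisson_admissible:
  fixes scale :: "'k::field_char_0 \<Rightarrow> 'v::ab_group_add \<Rightarrow> 'v"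
  assumes "bilinear_algebra scale mult" and comm: "\<And>x y. mult x y = mult y x"
  shows "associative_algebra scale mult \<longleftrightarrow> poisson_admissible_algebra scale mult"
proof -
  interpret bilinear_algebra scale mult by fact
  \<comment> \<open>Characteristic zero enters here: 2 is invertible, so
    \<open>1 / 2 + 1 / 2 = 1\<close>.\<close>
  have half: "scale (1 / 2) (v + v) = v" for v
    using scale_left_distrib[of "1 / 2" "1 / 2" v] by (simp add: scale_right_distrib)
  have circ: "(\<lambda>x y. scale (1 / 2) (mult x y + mult y x)) = mult"
    by (intro ext) (metis half comm)
  have bracket: "(\<lambda>x y. mult x y - mult y x) = (\<lambda>x y. 0)"
    by (intro ext) (metis comm diff_self)
  \<comment> \<open>Rewriting with \<open>circ\<close> and \<open>bracket\<close> leaves a Poisson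
    algebra on \<open>mult\<close> itself with zero bracket.\<close>
  have "poisson_admissible_algebra scale mult \<longleftrightarrow> commutative_associative_algebra scale mult"
    using assms(1)
    by (simp only: poisson_admissible_algebra_def circ bracket
        poisson_algebra_zero_bracket_iff simp_thms)
  also have "\<dots> \<longleftrightarrow> associative_algebra scale mult"
    using comm
    by (auto simp: commutative_associative_algebra_def
        commutative_associative_algebra_axioms_def)
  finally show ?thesis by simp
qed

theorem lemma2p5:
  fixes scale :: "'k::field_char_0 \<Rightarrow> 'v::ab_group_add \<Rightarrow> 'v"
    and bracket :: "'v \<Rightarrow> 'v \<Rightarrow> 'v"
    and mult :: "'v \<Rightarrow> 'v \<Rightarrow> 'v"
  assumes "lie_algebra scale bracket"
    and "cpa_structure scale bracket mult"
  shows "((\<forall>x y z. mult x (bracket y z) = 0) \<longleftrightarrow> associative_algebra scale mult)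
    \<and> (associative_algebra scale mult \<longleftrightarrow> poisson_admissible_algebra scale mult)"
proof -
  interpret cpa_structure scale bracket mult by fact
  show ?thesis
    using bracket_annihilates_iff_associative
      associative_iff_poisson_admissible[OF product.bilinear_algebra_axioms product_comm]
    by blast
qed

end
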